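(* Let $d\ge 2$, $n\in\{1,\dots,d\}$ and $\alpha\ge d-1$. Let $L$ be the infinitesimal generator (on $\mathcal{S}_d(\mathbb{R})$) associated to the Wishart process $\mathrm{WIS}_d(x,\alpha,0,I^n_d)$ and, for $i\in\{1,\dots,d\}$, let $L_{e^i_d}$ be the generator associated to $\mathrm{WIS}_d(x,\alpha,0,e^i_d)$. Then $$L=\sum_{i=1}^n L_{e^i_d}\qquad\text{and}\qquad \forall i,j\in\{1,\dots,d\},\quad L_{e^i_d}L_{e^j_d}=L_{e^j_d}L_{e^i_d}.$$
   Context: $\mathcal{M}_d(\mathbb{R})$, $\mathcal{S}_d(\mathbb{R})$, $\mathcal{S}_d^+(\mathbb{R})$ denote respectively the real $d\times d$ matrices, the symmetric ones, and the symmetric positive semidefinite ones. $I^n_d=(\mathbf 1_{i=j\le n})_{1\le i,j\le d}$ and $e^n_d=(\mathbf 1_{i=j=n})_{1\le i,j\le d}$, so $I^n_d=\sum_{i=1}^n e^i_d$. For $x\in\mathcal{S}_d^+(\mathbb{R})$, $\alpha\ge d-1$, $a,b\in\mathcal{M}_d(\mathbb{R})$, the Wishart process $\mathrm{WIS}_d(x,\alpha,b,a)$ is the law of the unique weak solution in $\mathcal{S}_d^+(\mathbb{R})$ of $$X_t=x+\int_0^t(\alpha a^Ta+bX_s+X_sb^T)\,ds+\int_0^t\big(\sqrt{X_s}\,dW_s\,a+a^T\,dW_s^T\sqrt{X_s}\big),$$ where $W$ is a $d\times d$ matrix of independent standard Brownian motions and $\sqrt{\cdot}$ is the positive semidefinite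 square root. For $x\in\mathcal{S}_d(\mathbb{R})$ write $x_{\{i,j\}}=x_{i,j}=x_{j,i}$; functions on $\mathcal{S}_d(\mathbb{R})$ are seen as functions of the $d(d+1)/2$ coordinates $x_{\{i,j\}}$, $i\le j$, and $\partial_{\{i,j\}}$ is the partial derivative with respect to $x_{\{i,j\}}$. The generator on $\mathcal{S}_d(\mathbb{R})$ of $\mathrm{WIS}_d(x,\alpha,0,a)$ is the second-order differential operator (acting on smooth functions on $\mathcal S_d(\mathbb R)$) $$\alpha\,\mathrm{Tr}(a^Ta\,D^{\mathcal S})+2\,\mathrm{Tr}(x D^{\mathcal S}a^Ta D^{\mathcal S}),\qquad D^{\mathcal S}_{i,j}=\big(\mathbf 1_{i=j}+\tfrac12\mathbf 1_{i\ne j}\big)\partial_{\{i,j\}},$$ where the derivatives do not act on the coefficient $x$. The products $L_{e^i_d}L_{e^j_d}$ are compositions of differential operators. *)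

theory Defs
  imports "HOL-Analysis.Analysis"
begin

text \<open>
  The index set \<open>{1,\<dots>,d}\<close> is a finite linearly ordered type \<open>'d\<close> with \<open>d = CARD('d)\<close>;
  \<open>pos i\<close> is the place of \<open>i\<close> in the order, counted from 1.
\<close>

definition pos :: "'d::{finite,linorder} \<Rightarrow> nat" where
  "pos i = card {j. j \<le> i}"

lemma bij_betw_pos: "bij_betw (pos :: 'd::{finite,linorder} \<Rightarrow> nat) UNIV {1..CARD('d)}"
proof -
  have less: "pos i < pos j" if "i < j" for i j :: 'd
    unfolding pos_def using that by (intro psubset_card_mono) force+
  have inj: "inj (pos :: 'd \<Rightarrow> nat)"
    using less by (metis injI less_irrefl linorder_neqE)
  have "pos i \<in> {1..CARD('d)}" for i :: 'd
  proof -
    have "card {i} \<le> card {j. j \<le> i}" "card {j. j \<le> i} \<le> CARD('d)"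
      by (rule card_mono; simp)+
    then show ?thesis by (simp add: pos_def)
  qed
  then have sub: "range (pos :: 'd \<Rightarrow> nat) \<subseteq> {1..CARD('d)}" by auto
  have "card (range (pos :: 'd \<Rightarrow> nat)) = card {1..CARD('d)}"
    using inj by (simp add: card_image)
  with sub have "range (pos :: 'd \<Rightarrow> nat) = {1..CARD('d)}"
    by (intro card_subset_eq) auto
  with inj show ?thesis by (simp add: bij_betw_def)
qed

definition I_mat :: "nat \<Rightarrow> real^('d::{finite,linorder})^('d::{finite,linorder})" where
  "I_mat n = (\<chi> i j. if i = j \<and> pos j \<le> n then 1 else 0)"

definition e_mat :: "nat \<Rightarrow> real^('d::{finite,linorder})^('d::{finite,linorder})" where
  "e_mat n = (\<chi> i j. if i = j \<and> pos j = n then 1 else 0)"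

lemma I_mat_eq_sum: "(I_mat n :: real^('d::{finite,linorder})^('d::{finite,linorder})) = (\<Sum>m=1..n. e_mat m)"
proof -
  have "pos j \<ge> 1" for j :: 'd
    using bij_betw_pos[where 'd = 'd] by (auto simp: bij_betw_def)
  then show ?thesis
    by (auto simp: I_mat_def e_mat_def vec_eq_iff)
qed

definition sym_mats :: "(real^'d^'d) set" where
  "sym_mats = {x. transpose x = x}"

text \<open>
  A function on the symmetric matrices is given by a function on all square matrices of which
  only the values on \<open>sym_mats\<close> matter. Moving the single coordinate \<open>x\<^sub>{\<^sub>i\<^sub>,\<^sub>j\<^sub>}\<close> means
  moving the entries \<open>(i,j)\<close> and \<open>(j,i)\<close> together, so the partial derivative with respect to
  that coordinate is the derivative in the direction \<open>sym_dir i j\<close>.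
\<close>

definition sym_dir :: "'d \<Rightarrow> 'd \<Rightarrow> real^'d^'d" where
  "sym_dir i j = (\<chi> k l. if {k, l} = {i, j} then 1 else 0)"

lemma sym_dir_in_sym_mats: "x \<in> sym_mats \<Longrightarrow> x + t *\<^sub>R sym_dir i j \<in> sym_mats"
  by (auto simp: sym_mats_def sym_dir_def transpose_def vec_eq_iff insert_commute)

definition sym_partial ::
  "'d \<Rightarrow> 'd \<Rightarrow> (real^'d^'d \<Rightarrow> real) \<Rightarrow> real^'d^'d \<Rightarrow> real" where
  "sym_partial i j f x = deriv (\<lambda>t. f (x + t *\<^sub>R sym_dir i j)) 0"

primrec sym_Ck :: "nat \<Rightarrow> (real^'d^'d \<Rightarrow> real) \<Rightarrow> bool" where
  "sym_Ck 0 f \<longleftrightarrow> continuous_on sym_mats f"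
| "sym_Ck (Suc k) f \<longleftrightarrow> continuous_on sym_mats f \<and>
     (\<forall>i j. (\<forall>x\<in>sym_mats. (\<lambda>t. f (x + t *\<^sub>R sym_dir i j)) differentiable (at 0)) \<and>
            sym_Ck k (sym_partial i j f))"

definition sym_smooth :: "(real^'d^'d \<Rightarrow> real) \<Rightarrow> bool" where
  "sym_smooth f \<longleftrightarrow> (\<forall>k. sym_Ck k f)"

definition DS :: "'d \<Rightarrow> 'd \<Rightarrow> (real^'d^'d \<Rightarrow> real) \<Rightarrow> real^'d^'d \<Rightarrow> real" where
  "DS i j f x = (if i = j then 1 else 1/2) * sym_partial i j f x"

text \<open>
  \<open>\<alpha> Tr(a\<^sup>T a D) + 2 Tr(x D a\<^sup>T a D)\<close> for the matrix \<open>D\<close> of operators \<open>DS i j\<close>: products of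
  operator entries are compositions, and the factor \<open>x\<close> stays outside all derivatives.
\<close>

definition wishart_generator ::
  "real \<Rightarrow> real^'d^'d \<Rightarrow> (real^'d^'d \<Rightarrow> real) \<Rightarrow> real^'d^'d \<Rightarrow> real" where
  "wishart_generator \<alpha> a f x =
     (let m = transpose a ** a in
        \<alpha> * trace (m ** (\<chi> i j. DS i j f x)) +
        2 * trace (x ** (\<chi> i j. \<Sum>k\<in>UNIV. \<Sum>l\<in>UNIV. DS i k (\<lambda>y. m $ k $ l * DS l j f y) x)))"

end

theory Submission
  imports Defs
begin

text \<open>
  Write \<open>D\<^sub>i\<^sub>j\<close> for \<open>DS i j\<close>. Both \<open>I\<^sup>n\<close> and \<open>e\<^sup>m\<close> are diagonal matrices with entries 0 and 1, and
  for such a matrix \<open>a\<close> the generator is the sum, over the indices \<open>q\<close> with \<open>a\<^sub>q\<^sub>q = 1\<close>, of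
  \<open>A\<^sub>q = \<alpha> D\<^sub>q\<^sub>q + 2 \<Sum>\<^sub>i\<^sub>j x\<^sub>i\<^sub>j D\<^sub>j\<^sub>q D\<^sub>q\<^sub>i\<close> (\<open>wishart_generator_indicator_diag\<close>). This gives the first claim
  and reduces the second one to \<open>A\<^sub>p A\<^sub>q = A\<^sub>q A\<^sub>p\<close>.

  By Clairaut's theorem (\<open>sym_partial_commute\<close>) the \<open>D\<^sub>i\<^sub>j\<close> commute on smooth functions,
  and \<open>D\<^sub>i\<^sub>j x\<^sub>a\<^sub>b = (\<delta>\<^sub>i\<^sub>a \<delta>\<^sub>j\<^sub>b + \<delta>\<^sub>i\<^sub>b \<delta>\<^sub>j\<^sub>a) / 2\<close>. Hence the product rule turns
  \<open>D\<^sub>i\<^sub>j (\<Sum>\<^sub>a\<^sub>b x\<^sub>a\<^sub>b G\<^sub>a\<^sub>b)\<close> into \<open>\<Sum>\<^sub>a\<^sub>b x\<^sub>a\<^sub>b D\<^sub>i\<^sub>j G\<^sub>a\<^sub>b + (G\<^sub>i\<^sub>j + G\<^sub>j\<^sub>i) / 2\<close> (\<open>DS_add_trace_form\<close>).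
  Applied twice, this expands \<open>A\<^sub>p A\<^sub>q f\<close> (\<open>wishart_diag_compose\<close>). The terms in which no derivative
  falls on a coefficient \<open>x\<^sub>a\<^sub>b\<close> are exchanged correctly when \<open>p\<close> and \<open>q\<close> are swapped, because the
  \<open>D\<^sub>i\<^sub>j\<close> commute. The terms in which one does are \<open>2 \<alpha> D\<^sub>p\<^sub>q D\<^sub>p\<^sub>q f\<close> and
  \<open>4 \<Sum>\<^sub>i\<^sub>j x\<^sub>i\<^sub>j (D\<^sub>j\<^sub>p D\<^sub>i\<^sub>q + D\<^sub>i\<^sub>p D\<^sub>j\<^sub>q) D\<^sub>p\<^sub>q f\<close>, and each of them is symmetric in \<open>p\<close> and \<open>q\<close>.
\<close>

section \<open>Equality of mixed second derivatives\<close>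

text \<open>
  Two applications of the mean value theorem, first in \<open>s\<close> to \<open>F s h - F s 0\<close> and then in \<open>t\<close>. The
  left-hand side does not change when the arguments of \<open>F\<close> are exchanged, so it is also a multiple
  of the other mixed derivative; letting \<open>h\<close> tend to 0 gives the next lemma.
\<close>

lemma second_difference_mean_value:
  fixes F Fs Fst :: "real \<Rightarrow> real \<Rightarrow> real"
  assumes "h > 0"
    and Fs: "\<And>s t. ((\<lambda>s. F s t) has_real_derivative Fs s t) (at s)"
    and Fst: "\<And>s t. ((\<lambda>t. Fs s t) has_real_derivative Fst s t) (at t)"
  shows "\<exists>s t. 0 < s \<and> s < h \<and> 0 < t \<and> t < h \<and>
           F h h - F h 0 - F 0 h + F 0 0 = h\<^sup>2 * Fst s t"
proof -
  have "((\<lambda>s. F s h - F s 0) has_real_derivative (Fs s h - Fs s 0)) (at s)" for s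
    by (intro DERIV_diff Fs)
  from MVT2[OF \<open>h > 0\<close> this] obtain s where s: "0 < s" "s < h"
    "(F h h - F h 0) - (F 0 h - F 0 0) = (h - 0) * (Fs s h - Fs s 0)"
    by blast
  from MVT2[OF \<open>h > 0\<close> Fst] obtain t where t: "0 < t" "t < h"
    "Fs s h - Fs s 0 = (h - 0) * Fst s t"
    by blast
  have "F h h - F h 0 - F 0 h + F 0 0 = h\<^sup>2 * Fst s t"
    using s(3) unfolding t(3) by (simp add: power2_eq_square)
  then show ?thesis using s t by blast
qed

text \<open>
  Clairaut's theorem from continuity of the mixed partial derivatives: total differentiability of
  \<open>F\<close> and its first derivatives is not assumed.
\<close>

lemma mixed_second_derivatives_eq:
  fixes F Fs Ft Fst Fts :: "real \<Rightarrow> real \<Rightarrow> real"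
  assumes Fs: "\<And>s t. ((\<lambda>s. F s t) has_real_derivative Fs s t) (at s)"
    and Ft: "\<And>s t. ((\<lambda>t. F s t) has_real_derivative Ft s t) (at t)"
    and Fst: "\<And>s t. ((\<lambda>t. Fs s t) has_real_derivative Fst s t) (at t)"
    and Fts: "\<And>s t. ((\<lambda>s. Ft s t) has_real_derivative Fts s t) (at s)"
    and cont: "continuous_on UNIV (\<lambda>(s, t). Fst s t)" "continuous_on UNIV (\<lambda>(s, t). Fts s t)"
  shows "Fst 0 0 = Fts 0 0"
proof -
  have "\<bar>Fst 0 0 - Fts 0 0\<bar> \<le> e" if "e > 0" for e
  proof -
    have "\<exists>d>0. \<forall>s t. 0 < s \<longrightarrow> s < d \<longrightarrow> 0 < t \<longrightarrow> t < d \<longrightarrow> \<bar>G s t - G 0 0\<bar> < e / 2"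
      if "continuous_on UNIV (\<lambda>(s, t). G s t)" for G :: "real \<Rightarrow> real \<Rightarrow> real"
    proof -
      from that have "isCont (\<lambda>(s, t). G s t) (0, 0)"
        by (simp add: continuous_on_eq_continuous_at)
      then obtain d where d: "d > 0"
        "\<And>z. dist z (0, 0) < d \<Longrightarrow> dist (case z of (s, t) \<Rightarrow> G s t) (G 0 0) < e / 2"
        unfolding continuous_at_eps_delta using half_gt_zero[OF \<open>e > 0\<close>] by fastforce
      have "\<bar>G s t - G 0 0\<bar> < e / 2" if "0 < s" "s < d / 2" "0 < t" "t < d / 2" for s t
      proof -
        have "dist (s, t) (0, 0) \<le> \<bar>s\<bar> + \<bar>t\<bar>"
          by (simp add: dist_Pair_Pair sqrt_sum_squares_le_sum_abs)
        with that have "dist (s, t) (0, 0) < d" by linarith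
        from d(2)[OF this] show ?thesis by (simp add: dist_real_def)
      qed
      with \<open>d > 0\<close> show ?thesis by (intro exI[of _ "d / 2"]) auto
    qed
    note near_0 = this
    obtain d1 where d1: "d1 > 0"
      "\<And>s t. 0 < s \<Longrightarrow> s < d1 \<Longrightarrow> 0 < t \<Longrightarrow> t < d1 \<Longrightarrow> \<bar>Fst s t - Fst 0 0\<bar> < e / 2"
      using near_0[OF cont(1)] by blast
    obtain d2 where d2: "d2 > 0"
      "\<And>s t. 0 < s \<Longrightarrow> s < d2 \<Longrightarrow> 0 < t \<Longrightarrow> t < d2 \<Longrightarrow> \<bar>Fts s t - Fts 0 0\<bar> < e / 2"
      using near_0[OF cont(2)] by blast
    define h where "h = min d1 d2"
    have h: "h > 0" "h \<le> d1" "h \<le> d2" using d1 d2 by (auto simp: h_def)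
    obtain s t where st: "0 < s" "s < h" "0 < t" "t < h"
      "F h h - F h 0 - F 0 h + F 0 0 = h\<^sup>2 * Fst s t"
      using second_difference_mean_value[of h F, OF h(1) Fs Fst] by blast
    obtain t' s' where st': "0 < t'" "t' < h" "0 < s'" "s' < h"
      "F h h - F 0 h - F h 0 + F 0 0 = h\<^sup>2 * Fts s' t'"
      using second_difference_mean_value[of h "\<lambda>t s. F s t", OF h(1) Ft Fts] by blast
    from st(5) st'(5) have "h\<^sup>2 * Fst s t = h\<^sup>2 * Fts s' t'" by linarith
    then have "Fst s t = Fts s' t'" using h(1) by simp
    with d1(2)[of s t] d2(2)[of s' t'] st st' h show ?thesis by linarith
  qed
  then show ?thesis
    using field_le_epsilon[of "\<bar>Fst 0 0 - Fts 0 0\<bar>" 0] by simp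
qed

section \<open>Calculus on the symmetric matrices\<close>

lemma sym_dir_commute: "sym_dir i j = sym_dir j i"
  by (simp add: sym_dir_def insert_commute)

lemma sym_partial_cong:
  assumes "\<And>y. y \<in> sym_mats \<Longrightarrow> f y = g y" "x \<in> sym_mats"
  shows "sym_partial i j f x = sym_partial i j g x"
  unfolding sym_partial_def using assms sym_dir_in_sym_mats by metis

text \<open>
  Smoothness depends only on the values at symmetric matrices. This matters because the identities
  for derivatives, such as the sum rule, hold only there: elsewhere \<open>deriv\<close> may be unspecified.
\<close>

lemma sym_Ck_cong:
  assumes "\<And>y. y \<in> sym_mats \<Longrightarrow> f y = g y"
  shows "sym_Ck k f \<longleftrightarrow> sym_Ck k g"
  using assms
proof (induction k arbitrary: f g)
  case 0
  then show ?case by (simp cong: continuous_on_cong)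
next
  case (Suc k)
  have "sym_Ck k (sym_partial i j f) = sym_Ck k (sym_partial i j g)" for i j
    using Suc.prems by (intro Suc.IH sym_partial_cong)
  moreover have "(\<lambda>t. f (x + t *\<^sub>R sym_dir i j)) = (\<lambda>t. g (x + t *\<^sub>R sym_dir i j))"
    if "x \<in> sym_mats" for x i j
    using Suc.prems sym_dir_in_sym_mats[OF that] by auto
  moreover have "continuous_on sym_mats f = continuous_on sym_mats g"
    using Suc.prems by (simp cong: continuous_on_cong)
  ultimately show ?case by simp
qed

lemma sym_Ck_Suc_has_derivative:
  assumes "sym_Ck (Suc k) f" "x \<in> sym_mats"
  shows "((\<lambda>t. f (x + t *\<^sub>R sym_dir i j)) has_real_derivative sym_partial i j f x) (at 0)"
  using assms unfolding sym_partial_def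
  by (auto simp flip: DERIV_deriv_iff_real_differentiable)

lemma sym_Ck_lincomb:
  assumes "sym_Ck k f" "sym_Ck k g"
  shows "sym_Ck k (\<lambda>y. a * f y + b * g y)"
  using assms
proof (induction k arbitrary: f g)
  case 0
  then show ?case by (auto intro!: continuous_intros)
next
  case (Suc k)
  let ?h = "\<lambda>y. a * f y + b * g y"
  have der: "((\<lambda>t. ?h (x + t *\<^sub>R sym_dir i j)) has_real_derivative
      a * sym_partial i j f x + b * sym_partial i j g x) (at 0)" if "x \<in> sym_mats" for x i j
    using Suc.prems that by (intro DERIV_add DERIV_cmult sym_Ck_Suc_has_derivative)
  then have "sym_partial i j ?h x = a * sym_partial i j f x + b * sym_partial i j g x"
    if "x \<in> sym_mats" for x i j
    using that unfolding sym_partial_def[of i j ?h] by (intro DERIV_imp_deriv)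
  then have "sym_Ck k (sym_partial i j ?h) \<longleftrightarrow>
      sym_Ck k (\<lambda>y. a * sym_partial i j f y + b * sym_partial i j g y)" for i j
    by (rule sym_Ck_cong)
  moreover have "sym_Ck k (\<lambda>y. a * sym_partial i j f y + b * sym_partial i j g y)" for i j
    using Suc.prems by (intro Suc.IH) auto
  moreover have "continuous_on sym_mats ?h"
    using Suc.prems by (auto intro!: continuous_intros)
  moreover have "(\<lambda>t. ?h (x + t *\<^sub>R sym_dir i j)) differentiable (at 0)" if "x \<in> sym_mats" for x i j
    using der[OF that] unfolding real_differentiable_def by blast
  ultimately show ?case by simp
qed

lemma sym_smooth_lincomb:
  "sym_smooth f \<Longrightarrow> sym_smooth g \<Longrightarrow> sym_smooth (\<lambda>y. a * f y + b * g y)"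
  by (simp add: sym_smooth_def sym_Ck_lincomb)

lemma sym_smooth_sym_partial: "sym_smooth f \<Longrightarrow> sym_smooth (sym_partial i j f)"
  unfolding sym_smooth_def by (metis sym_Ck.simps(2))

lemma sym_smooth_continuous: "sym_smooth f \<Longrightarrow> continuous_on sym_mats f"
  unfolding sym_smooth_def by (metis sym_Ck.simps(1))

lemma sym_smooth_has_derivative:
  assumes "sym_smooth f" "x \<in> sym_mats"
  shows "((\<lambda>t. f (x + t *\<^sub>R sym_dir i j)) has_real_derivative sym_partial i j f x) (at 0)"
  using assms sym_Ck_Suc_has_derivative unfolding sym_smooth_def by blast

lemma sym_smooth_has_derivative_line:
  assumes "sym_smooth f" "x \<in> sym_mats"
  shows "((\<lambda>t. f (x + t *\<^sub>R sym_dir i j)) has_real_derivative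
           sym_partial i j f (x + s *\<^sub>R sym_dir i j)) (at s)"
proof -
  have "((\<lambda>t. f ((x + s *\<^sub>R sym_dir i j) + t *\<^sub>R sym_dir i j)) has_real_derivative
           sym_partial i j f (x + s *\<^sub>R sym_dir i j)) (at 0)"
    using assms by (intro sym_smooth_has_derivative sym_dir_in_sym_mats)
  then show ?thesis
    using DERIV_shift[of "\<lambda>t. f (x + t *\<^sub>R sym_dir i j)" _ 0 s]
    by (simp add: algebra_simps)
qed

text \<open>Clairaut's theorem on the plane through \<open>x\<close> spanned by the two coordinate directions.\<close>

lemma sym_partial_commute:
  assumes f: "sym_smooth f" and x: "x \<in> sym_mats"
  shows "sym_partial k l (sym_partial i j f) x = sym_partial i j (sym_partial k l f) x"
proof -
  define u where "u = sym_dir i j"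
  define v where "v = sym_dir k l"
  define pt where "pt = (\<lambda>s t. x + s *\<^sub>R u + t *\<^sub>R v)"
  have pt: "pt s t \<in> sym_mats" for s t
    unfolding pt_def u_def v_def by (intro sym_dir_in_sym_mats x)
  have der_s: "((\<lambda>s. g (pt s t)) has_real_derivative sym_partial i j g (pt s t)) (at s)"
    if "sym_smooth g" for g s t
    using sym_smooth_has_derivative_line[OF that, of "x + t *\<^sub>R v" i j s]
      sym_dir_in_sym_mats[OF x, of t k l]
    by (simp add: pt_def u_def v_def add_ac)
  have der_t: "((\<lambda>t. g (pt s t)) has_real_derivative sym_partial k l g (pt s t)) (at t)"
    if "sym_smooth g" for g s t
    using sym_smooth_has_derivative_line[OF that, of "x + s *\<^sub>R u" k l t]
      sym_dir_in_sym_mats[OF x, of s i j]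
    by (simp add: pt_def u_def v_def)
  have cont: "continuous_on UNIV (\<lambda>(s, t). g (pt s t))" if "sym_smooth g" for g
    unfolding case_prod_beta
  proof (rule continuous_on_compose2[OF sym_smooth_continuous[OF that]])
    show "continuous_on UNIV (\<lambda>z. pt (fst z) (snd z))"
      unfolding pt_def by (intro continuous_intros)
  qed (use pt in auto)
  have "sym_partial k l (sym_partial i j f) (pt 0 0) = sym_partial i j (sym_partial k l f) (pt 0 0)"
    by (rule mixed_second_derivatives_eq[where F = "\<lambda>s t. f (pt s t)"
          and Fs = "\<lambda>s t. sym_partial i j f (pt s t)" and Ft = "\<lambda>s t. sym_partial k l f (pt s t)"
          and Fst = "\<lambda>s t. sym_partial k l (sym_partial i j f) (pt s t)"
          and Fts = "\<lambda>s t. sym_partial i j (sym_partial k l f) (pt s t)"])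
      (intro der_s der_t cont sym_smooth_sym_partial f)+
  then show ?thesis by (simp add: pt_def)
qed

section \<open>The matrix of differential operators\<close>

lemma DS_sym: "DS i j = DS j i"
  by (auto simp: DS_def sym_partial_def sym_dir_commute[of i j] fun_eq_iff)

lemma DS_cong:
  "(\<And>y. y \<in> sym_mats \<Longrightarrow> f y = g y) \<Longrightarrow> x \<in> sym_mats \<Longrightarrow> DS i j f x = DS i j g x"
  unfolding DS_def using sym_partial_cong[of f g x i j] by simp

lemma DS_zero: "DS i j (\<lambda>y. 0) x = 0"
  by (simp add: DS_def sym_partial_def)

lemma DS_eqI:
  assumes "((\<lambda>t. f (x + t *\<^sub>R sym_dir i j)) has_real_derivative D) (at 0)"
  shows "DS i j f x = (if i = j then 1 else 1/2) * D"
  unfolding DS_def sym_partial_def using DERIV_imp_deriv[OF assms] by simp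

lemma sym_smooth_DS:
  assumes "sym_smooth f"
  shows "sym_smooth (DS i j f)"
  using sym_smooth_lincomb[OF sym_smooth_sym_partial[OF assms] sym_smooth_sym_partial[OF assms],
      of "if i = j then 1 else 1/2" i j 0 i j]
  by (simp add: DS_def[abs_def])

lemma DS_lincomb:
  assumes "sym_smooth f" "sym_smooth g" "x \<in> sym_mats"
  shows "DS i j (\<lambda>y. a * f y + b * g y) x = a * DS i j f x + b * DS i j g x"
proof -
  have "((\<lambda>t. a * f (x + t *\<^sub>R sym_dir i j) + b * g (x + t *\<^sub>R sym_dir i j)) has_real_derivative
      a * sym_partial i j f x + b * sym_partial i j g x) (at 0)"
    using assms by (intro DERIV_add DERIV_cmult sym_smooth_has_derivative)
  from DS_eqI[of "\<lambda>y. a * f y + b * g y", OF this] show ?thesis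
    by (simp add: DS_def algebra_simps)
qed

lemma DS_commute:
  assumes f: "sym_smooth f" and x: "x \<in> sym_mats"
  shows "DS i j (DS k l f) x = DS k l (DS i j f) x"
proof -
  have "DS i j (DS k l f) x =
      (if i = j then 1 else 1/2) * ((if k = l then 1 else 1/2) * sym_partial i j (sym_partial k l f) x)"
    for i j k l
  proof (rule DS_eqI)
    show "((\<lambda>t. DS k l f (x + t *\<^sub>R sym_dir i j)) has_real_derivative
        (if k = l then 1 else 1/2) * sym_partial i j (sym_partial k l f) x) (at 0)"
      unfolding DS_def[of k l]
      using sym_smooth_has_derivative[OF sym_smooth_sym_partial[OF f] x]
      by (intro DERIV_cmult)
  qed
  then show ?thesis using sym_partial_commute[OF f x, of i j k l] by simp
qed

text \<open>
  The inner exchange is established only at symmetric matrices, which suffices since \<open>DS i j\<close> does not see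
  other values (\<open>DS_cong\<close>).
\<close>

lemma DS_commute3:
  assumes f: "sym_smooth f" and x: "x \<in> sym_mats"
  shows "DS i j (DS k l (DS m n f)) x = DS k l (DS m n (DS i j f)) x"
proof -
  have "DS i j (DS k l (DS m n f)) x = DS k l (DS i j (DS m n f)) x"
    by (intro DS_commute sym_smooth_DS f x)
  also have "\<dots> = DS k l (DS m n (DS i j f)) x"
    by (intro DS_cong DS_commute f x)
  finally show ?thesis .
qed

lemma DS_commute4:
  assumes f: "sym_smooth f" and x: "x \<in> sym_mats"
  shows "DS i j (DS k l (DS m n (DS r s f))) x = DS m n (DS r s (DS i j (DS k l f))) x"
proof -
  have "DS i j (DS k l (DS m n (DS r s f))) x = DS i j (DS m n (DS r s (DS k l f))) x"
    by (intro DS_cong DS_commute3 f x)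
  also have "\<dots> = DS m n (DS r s (DS i j (DS k l f))) x"
    by (intro DS_commute3 sym_smooth_DS f x)
  finally show ?thesis .
qed

text \<open>
  The product rule, with \<open>D\<^sub>i\<^sub>j x\<^sub>a\<^sub>b = (\<delta>\<^sub>i\<^sub>a \<delta>\<^sub>j\<^sub>b + \<delta>\<^sub>i\<^sub>b \<delta>\<^sub>j\<^sub>a) / 2\<close>: the weight 1/2 off the diagonal in
  \<open>D\<^sub>i\<^sub>j\<close> makes this formula valid for \<open>i = j\<close> and for \<open>i \<noteq> j\<close> alike.
\<close>

lemma DS_add_trace_form:
  fixes g :: "real^'d^'d \<Rightarrow> real"
  assumes g: "sym_smooth g" and G: "\<And>a b. sym_smooth (G a b)" and x: "x \<in> sym_mats"
  shows "DS i j (\<lambda>y. g y + 2 * (\<Sum>a\<in>UNIV. \<Sum>b\<in>UNIV. y $ a $ b * G a b y)) x =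
    DS i j g x + 2 * (\<Sum>a\<in>UNIV. \<Sum>b\<in>UNIV. x $ a $ b * DS i j (G a b) x) + (G i j x + G j i x)"
proof -
  let ?c = "if i = j then 1 else 1/2 :: real"
  let ?P = "sym_partial i j"
  let ?u = "sym_dir i j :: real^'d^'d"
  have "((\<lambda>t. (x + t *\<^sub>R ?u) $ a $ b * G a b (x + t *\<^sub>R ?u)) has_real_derivative
      ?u $ a $ b * G a b x + ?P (G a b) x * x $ a $ b) (at 0)" for a b
  proof -
    have "((\<lambda>t. (x + t *\<^sub>R ?u) $ a $ b) has_real_derivative ?u $ a $ b) (at 0)"
      by (auto intro!: derivative_eq_intros)
    from DERIV_mult[OF this sym_smooth_has_derivative[OF G x, of a b i j]]
    show ?thesis by simp
  qed
  then have "((\<lambda>t. g (x + t *\<^sub>R ?u) + 2 * (\<Sum>a\<in>UNIV. \<Sum>b\<in>UNIV.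
        (x + t *\<^sub>R ?u) $ a $ b * G a b (x + t *\<^sub>R ?u))) has_real_derivative
      ?P g x + 2 * (\<Sum>a\<in>UNIV. \<Sum>b\<in>UNIV. ?u $ a $ b * G a b x + ?P (G a b) x * x $ a $ b)) (at 0)"
    by (intro DERIV_add DERIV_cmult DERIV_sum sym_smooth_has_derivative g x)
  then have "DS i j (\<lambda>y. g y + 2 * (\<Sum>a\<in>UNIV. \<Sum>b\<in>UNIV. y $ a $ b * G a b y)) x =
      ?c * (?P g x + 2 * (\<Sum>a\<in>UNIV. \<Sum>b\<in>UNIV. ?u $ a $ b * G a b x + ?P (G a b) x * x $ a $ b))"
    by (rule DS_eqI)
  also have "\<dots> = DS i j g x + 2 * (\<Sum>a\<in>UNIV. \<Sum>b\<in>UNIV. x $ a $ b * DS i j (G a b) x)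
      + 2 * (\<Sum>a\<in>UNIV. \<Sum>b\<in>UNIV. ?c * ?u $ a $ b * G a b x)"
    by (simp add: DS_def algebra_simps sum.distrib sum_distrib_left del: if_split)
  also have "(\<Sum>a\<in>UNIV. \<Sum>b\<in>UNIV. ?c * ?u $ a $ b * G a b x) = (\<Sum>a\<in>UNIV. \<Sum>b\<in>UNIV.
      ((if i = a then if j = b then G a b x else 0 else 0) +
       (if j = a then if i = b then G a b x else 0 else 0)) / 2)"
    by (intro sum.cong refl) (auto simp: sym_dir_def doubleton_eq_iff)
  also have "\<dots> = (G i j x + G j i x) / 2"
  proof -
    have *: "(\<Sum>a\<in>UNIV. \<Sum>b\<in>UNIV. if i = a then if j = b then G a b x else 0 else 0) = G i j x" for i j
    proof -
      have "(\<Sum>b\<in>UNIV. if i = a then if j = b then G a b x else 0 else 0) =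
          (if i = a then G a j x else 0)" for a
        by (cases "i = a") simp_all
      then show ?thesis by simp
    qed
    show ?thesis
      unfolding sum_divide_distrib[symmetric] sum.distrib by (simp add: *)
  qed
  finally show ?thesis by simp
qed

section \<open>Generators for diagonal 0-1 matrices\<close>

text \<open>The generator for the matrix whose only nonzero entry is a 1 at place \<open>(q,q)\<close>.\<close>

definition wishart_diag ::
  "real \<Rightarrow> 'd \<Rightarrow> (real^'d^'d \<Rightarrow> real) \<Rightarrow> real^'d^'d \<Rightarrow> real" where
  "wishart_diag \<alpha> q f x =
     \<alpha> * DS q q f x + 2 * (\<Sum>i\<in>UNIV. \<Sum>j\<in>UNIV. x $ i $ j * DS j q (DS q i f) x)"

lemma wishart_generator_indicator_diag:
  fixes P :: "'d::finite set"
  assumes a: "a = (\<chi> i j. if i = j \<and> j \<in> P then 1 else 0)"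
  shows "wishart_generator \<alpha> a f x = (\<Sum>q\<in>P. wishart_diag \<alpha> q f x)"
proof -
  have m: "transpose a ** a = a"
  proof -
    have "a $ k $ i * a $ k $ j = (if k = i then a $ i $ j else 0)" for i j k
      by (auto simp: a)
    then have "(\<Sum>k\<in>UNIV. a $ k $ i * a $ k $ j) = a $ i $ j" for i j
      by simp
    then show ?thesis
      by (simp add: transpose_def matrix_matrix_mult_def vec_eq_iff)
  qed
  have D: "(\<Sum>l\<in>UNIV. DS i k (\<lambda>y. a $ k $ l * DS l j f y) x) =
      (if k \<in> P then DS i k (DS k j f) x else 0)" for i j k
  proof -
    have "DS i k (\<lambda>y. a $ k $ l * DS l j f y) x =
        (if l = k then if k \<in> P then DS i k (DS k j f) x else 0 else 0)" for l
      by (auto simp: a DS_zero)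
    then show ?thesis by simp
  qed
  have "a $ i $ k * DS k i f x = (if k = i then if i \<in> P then DS i i f x else 0 else 0)" for i k
    by (auto simp: a)
  then have 1: "trace (a ** (\<chi> i j. DS i j f x)) = (\<Sum>q\<in>P. DS q q f x)"
    by (simp add: trace_def matrix_matrix_mult_def sum.If_cases)
  have "trace (x ** (\<chi> i j. \<Sum>k\<in>UNIV. \<Sum>l\<in>UNIV. DS i k (\<lambda>y. a $ k $ l * DS l j f y) x)) =
      (\<Sum>i\<in>UNIV. \<Sum>j\<in>UNIV. x $ i $ j * (\<Sum>q\<in>P. DS j q (DS q i f) x))"
    unfolding D by (simp add: trace_def matrix_matrix_mult_def sum.If_cases)
  also have "\<dots> = (\<Sum>i\<in>UNIV. \<Sum>q\<in>P. \<Sum>j\<in>UNIV. x $ i $ j * DS j q (DS q i f) x)"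
    unfolding sum_distrib_left by (intro sum.cong refl sum.swap)
  also have "\<dots> = (\<Sum>q\<in>P. \<Sum>i\<in>UNIV. \<Sum>j\<in>UNIV. x $ i $ j * DS j q (DS q i f) x)"
    by (rule sum.swap)
  finally show ?thesis
    unfolding wishart_generator_def m Let_def 1 wishart_diag_def
    by (simp add: sum.distrib sum_distrib_left)
qed

lemma wishart_generator_I_mat:
  "wishart_generator \<alpha> (I_mat n) f x = (\<Sum>q | pos q \<le> n. wishart_diag \<alpha> q f x)"
  by (rule wishart_generator_indicator_diag) (simp add: I_mat_def)

lemma wishart_generator_e_mat:
  "wishart_generator \<alpha> (e_mat m) f x = (\<Sum>q | pos q = m. wishart_diag \<alpha> q f x)"
  by (rule wishart_generator_indicator_diag) (simp add: e_mat_def)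

section \<open>Commutation\<close>

text \<open>
  The six terms are sorted by order and by the number of derivatives that fall on a coefficient
  \<open>x\<^sub>a\<^sub>b\<close> of the inner operator: this happens once in the third and in the sixth term, and never
  in the others.
  Two derivatives never fall on coefficients at once, since these are linear in \<open>x\<close>.
\<close>

lemma wishart_diag_compose:
  fixes f :: "real^'d^'d \<Rightarrow> real"
  assumes f: "sym_smooth f" and x: "x \<in> sym_mats"
  shows "wishart_diag \<alpha> p (wishart_diag \<alpha> q f) x =
      \<alpha>\<^sup>2 * DS p p (DS q q f) x
    + 2 * \<alpha> * (\<Sum>a\<in>UNIV. \<Sum>b\<in>UNIV. x $ a $ b * DS p p (DS b q (DS q a f)) x)
    + 2 * \<alpha> * DS p q (DS p q f) x
    + 2 * \<alpha> * (\<Sum>i\<in>UNIV. \<Sum>j\<in>UNIV. x $ i $ j * DS j p (DS p i (DS q q f)) x)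
    + 4 * (\<Sum>i\<in>UNIV. \<Sum>j\<in>UNIV. \<Sum>a\<in>UNIV. \<Sum>b\<in>UNIV.
          x $ i $ j * x $ a $ b * DS j p (DS p i (DS b q (DS q a f))) x)
    + 4 * (\<Sum>i\<in>UNIV. \<Sum>j\<in>UNIV.
          x $ i $ j * (DS j p (DS i q (DS p q f)) x + DS i p (DS j q (DS p q f)) x))"
proof -
  define G where "G = (\<lambda>a b. DS b q (DS q a f))"
  have G: "sym_smooth (G a b)" for a b
    unfolding G_def by (intro sym_smooth_DS f)
  have Gp: "G p k y = DS k q (DS p q f) y" "G k p y = DS k q (DS p q f) y"
    if "y \<in> sym_mats" for k y
    using DS_commute[OF f that, of p q k q] by (simp_all add: G_def DS_sym[of q])
  \<comment> \<open>A multiple of one function is a linear combination whose second factor is 0.\<close>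
  have smq: "sym_smooth (\<lambda>y. \<alpha> * DS q q f y)"
    using sym_smooth_lincomb[OF sym_smooth_DS[OF f] sym_smooth_DS[OF f], of \<alpha> q q 0 q q]
    by simp
  have Dq: "DS k l (\<lambda>y. \<alpha> * DS q q f y) y = \<alpha> * DS k l (DS q q f) y" if "y \<in> sym_mats" for k l y
    using DS_lincomb[OF sym_smooth_DS[OF f] sym_smooth_DS[OF f] that, of k l \<alpha> q q 0 q q]
    by simp
  have first: "DS p i (wishart_diag \<alpha> q f) y =
      (\<alpha> * DS p i (DS q q f) y + 2 * DS i q (DS p q f) y)
      + 2 * (\<Sum>a\<in>UNIV. \<Sum>b\<in>UNIV. y $ a $ b * DS p i (G a b) y)"
    if "y \<in> sym_mats" for i y
    unfolding wishart_diag_def[abs_def] G_def[symmetric]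
    using DS_add_trace_form[of _ G, OF smq G that, of p i] Dq[OF that, of p i] Gp[OF that, of i]
    by (simp add: G_def)
  have sm2: "sym_smooth (\<lambda>y. \<alpha> * DS p i (DS q q f) y + 2 * DS i q (DS p q f) y)" for i
    by (intro sym_smooth_lincomb sym_smooth_DS f)
  have second: "DS j p (DS p i (wishart_diag \<alpha> q f)) x =
      \<alpha> * DS j p (DS p i (DS q q f)) x + 2 * DS j p (DS i q (DS p q f)) x
      + 2 * (\<Sum>a\<in>UNIV. \<Sum>b\<in>UNIV. x $ a $ b * DS j p (DS p i (G a b)) x)
      + 2 * DS i p (DS j q (DS p q f)) x" for i j
  proof -
    have "DS j p (DS p i (wishart_diag \<alpha> q f)) x =
        DS j p (\<lambda>y. (\<alpha> * DS p i (DS q q f) y + 2 * DS i q (DS p q f) y)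
          + 2 * (\<Sum>a\<in>UNIV. \<Sum>b\<in>UNIV. y $ a $ b * DS p i (G a b) y)) x"
      by (intro DS_cong first x)
    also have "\<dots> = DS j p (\<lambda>y. \<alpha> * DS p i (DS q q f) y + 2 * DS i q (DS p q f) y) x
        + 2 * (\<Sum>a\<in>UNIV. \<Sum>b\<in>UNIV. x $ a $ b * DS j p (DS p i (G a b)) x)
        + (DS p i (G j p) x + DS p i (G p j) x)"
      by (intro DS_add_trace_form sm2 sym_smooth_DS G x)
    also have "DS j p (\<lambda>y. \<alpha> * DS p i (DS q q f) y + 2 * DS i q (DS p q f) y) x =
        \<alpha> * DS j p (DS p i (DS q q f)) x + 2 * DS j p (DS i q (DS p q f)) x"
      by (intro DS_lincomb sym_smooth_DS f x)
    also have "DS p i (G j p) x = DS p i (DS j q (DS p q f)) x"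
      by (intro DS_cong Gp x)
    also have "DS p i (G p j) x = DS p i (DS j q (DS p q f)) x"
      by (intro DS_cong Gp x)
    finally show ?thesis by (simp add: DS_sym[of p i])
  qed
  have sums: "(\<Sum>i\<in>UNIV. \<Sum>j\<in>UNIV. x $ i $ j * DS j p (DS p i (wishart_diag \<alpha> q f)) x) =
      \<alpha> * (\<Sum>i\<in>UNIV. \<Sum>j\<in>UNIV. x $ i $ j * DS j p (DS p i (DS q q f)) x)
      + 2 * (\<Sum>i\<in>UNIV. \<Sum>j\<in>UNIV.
          x $ i $ j * (DS j p (DS i q (DS p q f)) x + DS i p (DS j q (DS p q f)) x))
      + 2 * (\<Sum>i\<in>UNIV. \<Sum>j\<in>UNIV. \<Sum>a\<in>UNIV. \<Sum>b\<in>UNIV.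
          x $ i $ j * x $ a $ b * DS j p (DS p i (G a b)) x)"
  proof -
    have "x $ i $ j * DS j p (DS p i (wishart_diag \<alpha> q f)) x =
        \<alpha> * (x $ i $ j * DS j p (DS p i (DS q q f)) x)
        + 2 * (x $ i $ j * (DS j p (DS i q (DS p q f)) x + DS i p (DS j q (DS p q f)) x))
        + 2 * (\<Sum>a\<in>UNIV. \<Sum>b\<in>UNIV. x $ i $ j * x $ a $ b * DS j p (DS p i (G a b)) x)" for i j
    proof -
      have "(\<Sum>a\<in>UNIV. \<Sum>b\<in>UNIV. x $ i $ j * x $ a $ b * DS j p (DS p i (G a b)) x) =
          x $ i $ j * (\<Sum>a\<in>UNIV. \<Sum>b\<in>UNIV. x $ a $ b * DS j p (DS p i (G a b)) x)"
        by (simp only: sum_distrib_left mult.assoc)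
      then show ?thesis unfolding second by (simp only: ring_distribs mult.assoc mult.left_commute)
    qed
    then show ?thesis by (simp only: sum.distrib flip: sum_distrib_left)
  qed
  have "wishart_diag \<alpha> p (wishart_diag \<alpha> q f) x = \<alpha> * DS p p (wishart_diag \<alpha> q f) x
      + 2 * (\<Sum>i\<in>UNIV. \<Sum>j\<in>UNIV. x $ i $ j * DS j p (DS p i (wishart_diag \<alpha> q f)) x)"
    by (rule wishart_diag_def)
  then show ?thesis
    unfolding first[OF x] sums G_def by algebra
qed

lemma sum_rotate3:
  "(\<Sum>i\<in>A. \<Sum>j\<in>B. \<Sum>k\<in>C. t i j k) = (\<Sum>k\<in>C. \<Sum>i\<in>A. \<Sum>j\<in>B. t i j k)"
proof -
  have "(\<Sum>i\<in>A. \<Sum>j\<in>B. \<Sum>k\<in>C. t i j k) = (\<Sum>i\<in>A. \<Sum>k\<in>C. \<Sum>j\<in>B. t i j k)"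
    by (intro sum.cong refl sum.swap)
  also have "\<dots> = (\<Sum>k\<in>C. \<Sum>i\<in>A. \<Sum>j\<in>B. t i j k)"
    by (rule sum.swap)
  finally show ?thesis .
qed

lemma sum_swap_pairs:
  "(\<Sum>i\<in>A. \<Sum>j\<in>B. \<Sum>k\<in>C. \<Sum>l\<in>D. t i j k l) = (\<Sum>k\<in>C. \<Sum>l\<in>D. \<Sum>i\<in>A. \<Sum>j\<in>B. t i j k l)"
  by (rule trans[OF sum_rotate3]) (intro sum.cong refl sum_rotate3)

lemma wishart_diag_commute:
  assumes f: "sym_smooth f" and x: "x \<in> sym_mats"
  shows "wishart_diag \<alpha> p (wishart_diag \<alpha> q f) x = wishart_diag \<alpha> q (wishart_diag \<alpha> p f) x"
proof -
  have order2: "DS p p (DS q q f) x = DS q q (DS p p f) x"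
    by (intro DS_commute f x)
  have order3: "DS p p (DS b q (DS q a f)) x = DS b q (DS q a (DS p p f)) x" for p q a b
    by (intro DS_commute3 f x)
  have order4: "(\<Sum>i\<in>UNIV. \<Sum>j\<in>UNIV. \<Sum>a\<in>UNIV. \<Sum>b\<in>UNIV.
        x $ i $ j * x $ a $ b * DS j p (DS p i (DS b q (DS q a f))) x) =
      (\<Sum>i\<in>UNIV. \<Sum>j\<in>UNIV. \<Sum>a\<in>UNIV. \<Sum>b\<in>UNIV.
        x $ i $ j * x $ a $ b * DS j q (DS q i (DS b p (DS p a f))) x)" (is "?S p q = ?S q p")
  proof -
    have "?S p q = (\<Sum>a\<in>UNIV. \<Sum>b\<in>UNIV. \<Sum>i\<in>UNIV. \<Sum>j\<in>UNIV.
        x $ i $ j * x $ a $ b * DS j p (DS p i (DS b q (DS q a f))) x)"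
      by (rule sum_swap_pairs)
    also have "\<dots> = ?S q p"
      by (intro sum.cong refl) (simp only: DS_commute4[OF f x, of _ p p] mult.commute[of "x $ _ $ _" "x $ _ $ _"])
    finally show ?thesis .
  qed
  \<comment> \<open>Exchanging the first two operators maps each summand on the left to one on the right.\<close>
  have cross: "DS j p (DS i q (DS p q f)) x + DS i p (DS j q (DS p q f)) x =
      DS j q (DS i p (DS q p f)) x + DS i q (DS j p (DS q p f)) x" for i j
    using DS_commute[OF sym_smooth_DS[OF f] x, of j p i q p q]
      DS_commute[OF sym_smooth_DS[OF f] x, of i p j q p q]
    by (simp add: DS_sym[of q p])
  show ?thesis
    unfolding wishart_diag_compose[OF f x] order2 order3[of p] order3[of q] order4 cross DS_sym[of q p]
    by algebra
qed

theorem theorem7: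
  fixes n :: nat and \<alpha> :: real
    and L :: "(real^('d::{finite,linorder})^('d::{finite,linorder}) \<Rightarrow> real)
              \<Rightarrow> real^('d::{finite,linorder})^('d::{finite,linorder}) \<Rightarrow> real"
    and Le :: "nat \<Rightarrow> (real^('d::{finite,linorder})^('d::{finite,linorder}) \<Rightarrow> real)
              \<Rightarrow> real^('d::{finite,linorder})^('d::{finite,linorder}) \<Rightarrow> real"
  assumes "CARD('d) \<ge> 2" and "n \<in> {1..CARD('d)}" and "\<alpha> \<ge> real CARD('d) - 1"
    and "L = wishart_generator \<alpha> (I_mat n)"
    and "\<And>i. i \<in> {1..CARD('d)} \<Longrightarrow> Le i = wishart_generator \<alpha> (e_mat i)"
  shows "(\<forall>f. sym_smooth f \<longrightarrow> (\<forall>x\<in>sym_mats. L f x = (\<Sum>i=1..n. Le i f x))) \<and>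
         (\<forall>i\<in>{1..CARD('d)}. \<forall>j\<in>{1..CARD('d)}. \<forall>f. sym_smooth f \<longrightarrow>
            (\<forall>x\<in>sym_mats. (Le i \<circ> Le j) f x = (Le j \<circ> Le i) f x))"
proof (intro conjI allI impI ballI)
  fix f :: "real^('d::{finite,linorder})^('d::{finite,linorder}) \<Rightarrow> real"
    and x :: "real^('d::{finite,linorder})^('d::{finite,linorder})"
  have pos: "pos q \<in> {1..CARD('d)}" for q :: 'd
    using bij_betw_pos[where 'd = 'd] by (auto simp: bij_betw_def)
  have "(\<Sum>i=1..n. Le i f x) = (\<Sum>i=1..n. \<Sum>q | q \<in> {q. pos q \<le> n} \<and> pos q = i. wishart_diag \<alpha> q f x)"
  proof (rule sum.cong[OF refl])
    fix i assume i: "i \<in> {1..n}"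
    then have "{q :: 'd. q \<in> {q. pos q \<le> n} \<and> pos q = i} = {q. pos q = i}" by auto
    with i assms(2) show "Le i f x = (\<Sum>q | q \<in> {q. pos q \<le> n} \<and> pos q = i. wishart_diag \<alpha> q f x)"
      by (simp add: assms(5) wishart_generator_e_mat)
  qed
  also have "\<dots> = (\<Sum>q | pos q \<le> n. wishart_diag \<alpha> q f x)"
    using pos by (intro sum.group) auto
  finally show "L f x = (\<Sum>i=1..n. Le i f x)"
    by (simp add: assms(4) wishart_generator_I_mat)
next
  fix i j and f :: "real^('d::{finite,linorder})^('d::{finite,linorder}) \<Rightarrow> real"
    and x :: "real^('d::{finite,linorder})^('d::{finite,linorder})"
  assume ij: "i \<in> {1..CARD('d)}" "j \<in> {1..CARD('d)}" and f: "sym_smooth f" and x: "x \<in> sym_mats"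
  have Le: "\<exists>q. Le m = wishart_diag \<alpha> q" if m: "m \<in> {1..CARD('d)}" for m
  proof -
    obtain q :: 'd where q: "pos q = m"
      using m bij_betw_pos[where 'd = 'd] by (metis bij_betw_def imageE)
    then have "{r :: 'd. pos r = m} = {q}"
      using bij_betw_pos[where 'd = 'd] by (auto simp: bij_betw_def inj_def)
    then have "Le m g y = wishart_diag \<alpha> q g y" for g y
      by (simp add: assms(5)[OF m] wishart_generator_e_mat)
    then show ?thesis by blast
  qed
  from Le[OF ij(1)] Le[OF ij(2)] obtain p q where "Le i = wishart_diag \<alpha> p" "Le j = wishart_diag \<alpha> q"
    by blast
  then show "(Le i \<circ> Le j) f x = (Le j \<circ> Le i) f x"
    using wishart_diag_commute[OF f x] by simp
qed

end
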